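(* Let $p$ be prime. There exists $g\in\mathbb{C}^{\mathbb{Z}_p}$ with $|g(x)|=1$ for all $x\in\mathbb{Z}_p$ such that $\|f\|_0+\|V_gf\|_0\ge p^2+1$ for all $f\in\mathbb{C}^{\mathbb{Z}_p}\setminus\{0\}$, and such that, moreover, for all integers $1\le k\le p$ and $1\le l\le p^2$ with $k+l\ge p^2+1$ there exists $f\in\mathbb{C}^{\mathbb{Z}_p}$ with $\|f\|_0=k$ and $\|V_gf\|_0=l$.
   Context: $\mathbb{C}^{\mathbb{Z}_p}$ is the space of functions $\mathbb{Z}_p\to\mathbb{C}$; $\|\cdot\|_0$ is the number of points at which a function is nonzero. $\widehat{\mathbb{Z}_p}$ is the dual group (homomorphisms $\xi:\mathbb{Z}_p\to\{z\in\mathbb{C}:|z|=1\}$, $\langle\xi,x\rangle=\xi(x)$). The short-time Fourier transform with window $g\ne0$ is $V_gf(x,\xi)=\sum_{y\in\mathbb{Z}_p}f(y)\,\overline{g(y-x)}\,\overline{\langle\xi,y\rangle}$, $(x,\xi)\in\mathbb{Z}_p\times\widehat{\mathbb{Z}_p}$. *)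

theory Defs
  imports Complex_Main "Berlekamp_Zassenhaus.Finite_Field"
begin

text \<open>
  The group \<open>\<int>\<^sub>p\<close> is the type \<open>'p mod_ring\<close> of integers modulo \<open>CARD('p)\<close>; for
  \<open>'p\<close> of class \<open>prime_card\<close> the modulus \<open>p = CARD('p)\<close> is prime.
\<close>

definition dual_group :: "('p::finite mod_ring \<Rightarrow> complex) set" where
  "dual_group = {\<xi>. (\<forall>x. cmod (\<xi> x) = 1) \<and> (\<forall>x y. \<xi> (x + y) = \<xi> x * \<xi> y)}"

definition stft ::
  "('p::finite mod_ring \<Rightarrow> complex) \<Rightarrow> ('p mod_ring \<Rightarrow> complex) \<Rightarrow>
   'p mod_ring \<times> ('p mod_ring \<Rightarrow> complex) \<Rightarrow> complex" where
  "stft g f = (\<lambda>(x, \<xi>). \<Sum>y\<in>UNIV. f y * cnj (g (y - x)) * cnj (\<xi> y))"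

text \<open>
  The domain \<open>A\<close> is explicit because \<open>stft g f\<close> is a total function, but is only to be
  considered for \<open>\<xi>\<close> in the dual group.
\<close>

definition norm0 :: "'a set \<Rightarrow> ('a \<Rightarrow> complex) \<Rightarrow> nat" where
  "norm0 A f = card {x \<in> A. f x \<noteq> 0}"

text \<open>Finiteness of the dual group ensures that \<open>card\<close> in \<open>norm0\<close> never takes its
  default value for infinite sets.\<close>

lemma finite_dual_group: "finite (dual_group :: ('p::finite mod_ring \<Rightarrow> complex) set)"
proof -
  let ?n = "card (UNIV :: 'p mod_ring set)"
  have pos: "?n > 0"
    by (simp add: card_gt_0_iff)
  have "\<xi> x ^ ?n = 1" if "\<xi> \<in> dual_group" for \<xi> :: "'p mod_ring \<Rightarrow> complex" and x
  proof -
    have hom: "\<xi> (a + b) = \<xi> a * \<xi> b" and unit: "cmod (\<xi> a) = 1" for a b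
      using that by (simp_all add: dual_group_def)
    have nz: "\<xi> a \<noteq> 0" for a
      using unit[of a] by force
    have "bij (\<lambda>y. x + y)"
      by (rule bij_betwI[where g = "\<lambda>y. y - x"]) auto
    then have "(\<Prod>y\<in>UNIV. \<xi> (x + y)) = (\<Prod>y\<in>UNIV. \<xi> y)"
      by (rule prod.reindex_bij_betw)
    moreover have "(\<Prod>y\<in>UNIV. \<xi> (x + y)) = \<xi> x ^ ?n * (\<Prod>y\<in>UNIV. \<xi> y)"
      by (simp only: hom prod.distrib prod_constant)
    moreover have "(\<Prod>y\<in>UNIV. \<xi> y) \<noteq> 0"
      using nz by simp
    ultimately show ?thesis
      by (metis mult_cancel_right1)
  qed
  then have sub: "dual_group \<subseteq> (UNIV :: 'p mod_ring set) \<rightarrow>\<^sub>E {z::complex. z ^ ?n = 1}"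
    unfolding PiE_UNIV_domain by blast
  have "finite {z::complex. z ^ ?n = 1}"
    using pos by (intro finite_roots_unity) linarith
  then show ?thesis
    by (intro finite_subset[OF sub] finite_PiE) simp_all
qed

end

theory Submission
  imports
    Defs
    "Jordan_Normal_Form.Determinant"
    "Subresultants.Subresultant_Gcd"
    "HOL-Computational_Algebra.Field_as_Ring"
begin

text \<open>
  The map \<open>f \<mapsto> V\<^sub>g f\<close> is given by a matrix with \<open>p\<^sup>2\<close> rows, indexed by the pairs \<open>(x, \<xi>)\<close>, and \<open>p\<close>
  columns. Everything follows once \<open>g\<close> is chosen with unimodular values such that all square minors
  of this matrix are nonzero (\<open>exists_unimodular_window_with_nonzero_minors\<close>). A nonzero \<open>f\<close> with
  support of size \<open>k\<close> can then make at most \<open>k - 1\<close> entries of \<open>V\<^sub>g f\<close> vanish, which is the inequality.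
  Conversely, for a set \<open>J\<close> of \<open>k\<close> points and a set \<open>R\<close> of \<open>m = p\<^sup>2 - l < k\<close> rows, consider the
  functions supported in \<open>J\<close> with \<open>V\<^sub>g f\<close> vanishing on \<open>R\<close>. Any \<open>m + 1\<close> points of \<open>J\<close> carry a nonzero
  such function, which by the inequality vanishes at none of these points and whose transform has
  no zeros outside \<open>R\<close>. A generic element of the space therefore has support exactly \<open>J\<close> and a
  transform with zero set exactly \<open>R\<close>.

  To find \<open>g\<close>, take \<open>g c\<close> to be the conjugate of \<open>\<zeta> ^ N c\<close>, where \<open>\<zeta>\<close> lies on the unit circle and
  \<open>N c = 2 ^ c\<close> for \<open>c\<close> in \<open>{0..<p}\<close>. A minor is then a polynomial in \<open>\<zeta>\<close>. The weights \<open>N\<close> grow so fast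
  that an exchange argument (\<open>heaviest_permutations_agree\<close>) determines, for the terms of highest
  degree, the time coordinate of the row assigned to each column. The coefficient of highest degree
  is therefore, up to sign, a product of minors of the Fourier matrix of order \<open>p\<close>, and these are
  nonzero by Chebotarev's theorem (\<open>chebotarev_fourier_minors\<close>). All minors are thus nonzero polynomials,
  and all but finitely many \<open>\<zeta>\<close> work.

  Chebotarev's theorem is proved by replacing the rows of the minor by divided differences, whose
  determinant is the value at \<open>\<omega>\<close> of an integer polynomial. If it vanished, then \<open>p\<close> would divide
  the value of that polynomial at \<open>1\<close>, a determinant of binomial coefficients that is nonzero
  modulo \<open>p\<close>.
\<close>

section \<open>Integer polynomials at roots of unity\<close>

lemma X_minus_1: "[:0, 1:] - 1 = [:-1, 1 :: 'a :: comm_ring_1:]"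
  by (rule poly_eqI) (simp add: coeff_pCons split: nat.splits)

text \<open>
  The only arithmetic of cyclotomic fields that is needed: an integer polynomial vanishing at
  a primitive \<open>p\<close>-th root of unity is divisible by \<open>p\<close> at \<open>1\<close>. The greatest common divisor
  of \<open>F\<close> and \<open>\<Phi> = 1 + X + \<dots> + X ^ (p - 1)\<close> in \<open>\<int>[X]\<close> is not constant, since \<open>F\<close> and \<open>\<Phi>\<close>
  share a complex root. Modulo \<open>p\<close> it is still not constant and divides
  \<open>X ^ p - 1 = (X - 1) ^ p\<close>, so it vanishes at \<open>1\<close>.
\<close>

lemma prime_dvd_poly_1_if_root_of_unity:
  fixes F :: "int poly" and \<omega> :: complex
  assumes \<omega>: "\<omega> ^ CARD('p::prime_card) = 1" "\<omega> \<noteq> 1"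
    and root: "poly (of_int_poly F) \<omega> = 0"
  shows "int CARD('p) dvd poly F 1"
proof -
  define \<Phi> :: "int poly" where "\<Phi> = (\<Sum>i<CARD('p). [:0, 1:] ^ i)"
  have \<Phi>_fact: "[:-1, 1:] * \<Phi> = [:0, 1:] ^ CARD('p) - 1"
  proof -
    show ?thesis unfolding \<Phi>_def power_diff_1_eq X_minus_1 by simp
  qed
  have "poly (of_int_poly \<Phi>) \<omega> = (\<Sum>i<CARD('p). \<omega> ^ i)"
    by (simp add: \<Phi>_def hom_distribs poly_sum)
  also have "\<dots> = 0"
    using \<omega> by (simp add: geometric_sum)
  finally have \<Phi>0: "poly (of_int_poly \<Phi>) \<omega> = 0" .
  define D where "D = gcd F \<Phi>"
  have \<Phi>_nz: "\<Phi> \<noteq> 0"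
  proof
    assume "\<Phi> = 0"
    then have "poly \<Phi> 1 = 0" by simp
    then show False by (simp add: \<Phi>_def poly_sum)
  qed
  have "degree D \<noteq> 0"
  proof -
    let ?F = "of_int_poly F :: complex poly" and ?P = "of_int_poly \<Phi> :: complex poly"
    have "[:-\<omega>, 1:] dvd gcd ?F ?P"
      using root \<Phi>0 by (simp add: poly_eq_0_iff_dvd)
    moreover have "gcd ?F ?P \<noteq> 0" using \<Phi>_nz by simp
    ultimately have "degree (gcd ?F ?P) \<noteq> 0"
      by (metis degree_pCons_eq_if divides_degree le_zero_eq one_neq_zero pCons_eq_0_iff zero_neq_one One_nat_def Suc_neq_Zero)
    then have "resultant ?F ?P = 0" by (simp add: resultant_0_gcd)
    then have "resultant F \<Phi> = 0" by (simp add: of_int_hom.resultant_hom)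
    then show ?thesis by (simp add: resultant_0_gcd D_def)
  qed
  have "D dvd [:0, 1:] ^ CARD('p) - 1"
    unfolding \<Phi>_fact[symmetric] D_def by (intro dvd_mult) simp
  then obtain E where E: "[:0, 1:] ^ CARD('p) - 1 = D * E" by (elim dvdE)
  define r :: "int poly \<Rightarrow> 'p mod_ring poly" where "r = of_int_poly"
  have "r D * r E = [:0, 1:] ^ CARD('p) - 1"
    unfolding r_def of_int_poly_hom.hom_mult[symmetric] E[symmetric] by (simp add: hom_distribs)
  also have "\<dots> = ([:0, 1:] - 1) ^ CARD('p)"
  proof -
    have "([:0, 1:] - 1 + 1 :: 'p mod_ring poly) ^ CARD('p) = ([:0, 1:] - 1) ^ CARD('p) + 1 ^ CARD('p)"
      by (rule freshmans_dream) (simp_all add: prime_card)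
    then show ?thesis by simp
  qed
  finally have rDE: "r D * r E = [:-1, 1:] ^ CARD('p)" unfolding X_minus_1 .
  \<comment> \<open>Reduction modulo \<open>p\<close> cannot lower the degree of either factor, as the product keeps
    its degree.\<close>
  have "degree (r D) \<noteq> 0"
  proof -
    have "D * E \<noteq> 0"
    proof
      assume "D * E = 0"
      then have "poly ([:0, 1:] ^ CARD('p) - 1) (0 :: int) = 0" by (simp only: E poly_0)
      then show False by (simp add: zero_power)
    qed
    then have "degree D + degree E = degree (D * E)" by (simp add: degree_mult_eq)
    also have "\<dots> \<le> CARD('p)"
      unfolding E[symmetric] by (intro degree_diff_le) (auto intro: order_trans[OF degree_power_le])
    also have "\<dots> = degree (r D * r E)" unfolding rDE by (simp add: degree_power_eq)
    also have "\<dots> \<le> degree (r D) + degree (r E)" by (rule degree_mult_le)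
    finally have "degree D + degree E \<le> degree (r D) + degree (r E)" .
    moreover have "degree (r D) \<le> degree D" "degree (r E) \<le> degree E"
      by (simp_all add: r_def degree_map_poly_le)
    ultimately have "degree (r D) = degree D" by linarith
    then show ?thesis using \<open>degree D \<noteq> 0\<close> by simp
  qed
  have "poly (r D) 1 = 0"
  proof (rule ccontr)
    assume "poly (r D) 1 \<noteq> 0"
    then have "\<not> [:-1, 1:] dvd r D" by (simp add: poly_eq_0_iff_dvd)
    then have "coprime [:-1, 1:] (r D)"
      by (intro prime_elem_imp_coprime prime_elem_linear_field_poly) auto
    then have "coprime ([:-1, 1:] ^ CARD('p)) (r D)" by simp
    then have "is_unit (r D)" unfolding rDE[symmetric] by simp
    then show False using \<open>degree (r D) \<noteq> 0\<close> by (simp add: is_unit_iff_degree poly_dvd_1)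
  qed
  then have "of_int (poly D 1) = (0 :: 'p mod_ring)" 
    using of_int_hom.poly_map_poly[of D 1, where ?'a = "'p mod_ring"] by (simp add: r_def)
  moreover have "poly D 1 dvd poly F 1" by (auto simp: D_def intro: poly_hom.hom_dvd)
  ultimately have "of_int (poly F 1) = (0 :: 'p mod_ring)" by (auto elim!: dvdE)
  then show ?thesis using of_int_eq_0_iff_char_dvd[where ?'a = "'p mod_ring", of "poly F 1"] by simp
qed

section \<open>Chebotarev's theorem on the minors of the Fourier matrix\<close>

lemma det_eq_0_iff_right_kernel:
  fixes f :: "nat \<times> nat \<Rightarrow> 'a :: idom"
  shows "det (mat n n f) = 0 \<longleftrightarrow>
    (\<exists>v. (\<exists>j<n. v j \<noteq> 0) \<and> (\<forall>i<n. (\<Sum>j<n. f (i, j) * v j) = 0))"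
proof -
  have row: "(mat n n f *\<^sub>v v) $ i = (\<Sum>j<n. f (i, j) * v $ j)"
    if "v \<in> carrier_vec n" "i < n" for v i
    using that by (auto simp: scalar_prod_def atLeast0LessThan intro!: sum.cong)
  have "det (mat n n f) = 0 \<longleftrightarrow>
      (\<exists>v. v \<in> carrier_vec n \<and> v \<noteq> 0\<^sub>v n \<and> mat n n f *\<^sub>v v = 0\<^sub>v n)"
    by (rule det_0_iff_vec_prod_zero) simp
  also have "\<dots> \<longleftrightarrow> (\<exists>v. (\<exists>j<n. v j \<noteq> 0) \<and> (\<forall>i<n. (\<Sum>j<n. f (i, j) * v j) = 0))"
  proof (intro iffI; elim exE conjE)
    fix v assume v: "v \<in> carrier_vec n" "v \<noteq> 0\<^sub>v n" "mat n n f *\<^sub>v v = 0\<^sub>v n"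
    have "\<forall>i<n. (\<Sum>j<n. f (i, j) * v $ j) = 0"
      using row[OF v(1)] v(3) by (metis index_zero_vec(1))
    moreover have "\<exists>j<n. v $ j \<noteq> 0" using v(1,2) by (auto simp: vec_eq_iff)
    ultimately show "\<exists>v. (\<exists>j<n. v j \<noteq> 0) \<and> (\<forall>i<n. (\<Sum>j<n. f (i, j) * v j) = 0)" by blast
  next
    fix v j assume v: "j < n" "v j \<noteq> 0" "\<forall>i<n. (\<Sum>j<n. f (i, j) * v j) = 0"
    have "vec n v \<noteq> 0\<^sub>v n" using v(1,2) by (metis index_vec index_zero_vec(1))
    moreover have "mat n n f *\<^sub>v vec n v = 0\<^sub>v n"
    proof (rule eq_vecI)
      fix i assume "i < dim_vec (0\<^sub>v n :: 'a vec)"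
      then have "i < n" by simp
      then show "(mat n n f *\<^sub>v vec n v) $ i = 0\<^sub>v n $ i"
        using v(3) by (simp add: row del: index_mult_mat_vec)
    qed simp
    ultimately show "\<exists>v. v \<in> carrier_vec n \<and> v \<noteq> 0\<^sub>v n \<and> mat n n f *\<^sub>v v = 0\<^sub>v n"
      by (metis vec_carrier)
  qed
  finally show ?thesis .
qed

lemma det_eq_0_iff_left_kernel:
  fixes f :: "nat \<times> nat \<Rightarrow> 'a :: idom"
  shows "det (mat n n f) = 0 \<longleftrightarrow>
    (\<exists>v. (\<exists>i<n. v i \<noteq> 0) \<and> (\<forall>j<n. (\<Sum>i<n. v i * f (i, j)) = 0))"
proof -
  have "transpose_mat (mat n n f) = mat n n (\<lambda>(i, j). f (j, i))"
    by (rule eq_matI) auto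
  then have "det (mat n n f) = det (mat n n (\<lambda>(i, j). f (j, i)))"
    using det_transpose[of "mat n n f" n] by simp
  then show ?thesis by (simp add: det_eq_0_iff_right_kernel mult.commute)
qed

text \<open>
  Divided differences of the monomials: \<open>divdiff z i w y\<close> is the divided difference of \<open>X ^ y\<close>
  at the \<open>i + 1\<close> nodes \<open>z 0, \<dots>, z (i - 1), w\<close>. It equals the complete homogeneous symmetric
  polynomial of degree \<open>y - i\<close> in the nodes (\<open>0\<close> if \<open>y < i\<close>), and the recursion, which involves no
  division, is the one for these polynomials. Hence it makes sense for coinciding nodes and
  commutes with ring homomorphisms.
\<close>

fun divdiff :: "(nat \<Rightarrow> 'a :: comm_ring_1) \<Rightarrow> nat \<Rightarrow> 'a \<Rightarrow> nat \<Rightarrow> 'a" where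
  "divdiff z 0 w y = w ^ y"
| "divdiff z (Suc i) w 0 = 0"
| "divdiff z (Suc i) w (Suc y) = w * divdiff z (Suc i) w y + divdiff z i (z i) y"

text \<open>
  The defining quotient of divided differences, with the denominator cleared.
\<close>

lemma divdiff_Suc:
  "(w - z i) * divdiff z (Suc i) w y = divdiff z i w y - divdiff z i (z i) y"
proof (induction y)
  case 0
  show ?case by (cases i) simp_all
next
  case (Suc y)
  have "(w - z i) * divdiff z (Suc i) w (Suc y) =
      w * ((w - z i) * divdiff z (Suc i) w y) + (w - z i) * divdiff z i (z i) y"
    by (simp add: algebra_simps)
  also have "\<dots> = w * divdiff z i w y - z i * divdiff z i (z i) y"
    unfolding Suc.IH by (simp add: algebra_simps)
  also have "\<dots> = divdiff z i w (Suc y) - divdiff z i (z i) (Suc y)"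
    by (cases i) simp_all
  finally show ?case .
qed

lemma (in comm_ring_hom) hom_divdiff:
  "hom (divdiff z i w y) = divdiff (\<lambda>i. hom (z i)) i (hom w) y"
  by (induction z i w y rule: divdiff.induct) (simp_all add: hom_distribs)

lemma divdiff_one: "divdiff (\<lambda>_. 1) i 1 y = of_nat (y choose i)"
proof (induction "\<lambda>_::nat. 1::'a" i "1::'a" y rule: divdiff.induct)
qed (simp_all add: add.commute)

lemma of_nat_binomial_mult_fact:
  "of_nat (n choose i) * of_nat (fact i) = (\<Prod>l<i. of_nat n - of_nat l :: 'a :: comm_ring_1)"
proof (induction i)
  case (Suc i)
  have nat: "Suc i * (n choose Suc i) = (n - i) * (n choose i)"
    by (metis binomial_absorption binomial_absorb_comp)
  have "of_nat (n choose Suc i) * of_nat (fact (Suc i)) = (of_nat (Suc i * (n choose Suc i)) * of_nat (fact i) :: 'a)"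
    by (simp only: fact_Suc of_nat_mult of_nat_id ac_simps)
  also have "\<dots> = of_nat (n - i) * (of_nat (n choose i) * of_nat (fact i))"
    unfolding nat by (simp only: of_nat_mult ac_simps)
  also have "\<dots> = (of_nat n - of_nat i) * (of_nat (n choose i) * of_nat (fact i))"
  proof (cases "i \<le> n")
    case True
    show ?thesis unfolding of_nat_diff[OF True] by simp
  qed (simp add: binomial_eq_0)
  finally show ?case unfolding Suc.IH by (simp add: mult.commute)
qed simp

text \<open>
  The matrix of the binomial coefficients \<open>y j choose i\<close> is invertible modulo \<open>p\<close>: a linear
  relation between its rows is a polynomial of degree less than \<open>k\<close> with the \<open>k\<close> distinct roots
  \<open>y j\<close>, and the polynomials \<open>X choose i\<close> for \<open>i < k \<le> p\<close> are linearly independent.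
\<close>

lemma binomial_left_kernel_trivial:
  fixes c :: "nat \<Rightarrow> 'p :: prime_card mod_ring" and y :: "nat \<Rightarrow> nat"
  assumes y: "inj_on y {..<k}" "\<And>j. j < k \<Longrightarrow> y j < CARD('p)"
    and c: "\<And>j. j < k \<Longrightarrow> (\<Sum>i<k. c i * of_nat (y j choose i)) = 0"
    and "i < k"
  shows "c i = 0"
proof -
  have "k \<le> CARD('p)"
    using card_inj_on_le[OF y(1), of "{..<CARD('p)}"] y(2) by auto
  have fact_nz: "of_nat (fact i) \<noteq> (0 :: 'p mod_ring)" if "i < k" for i
  proof
    assume "of_nat (fact i) = (0 :: 'p mod_ring)"
    then have "CARD('p) dvd fact i" by (rule of_nat_0_mod_ring_dvd)
    then show False using that \<open>k \<le> CARD('p)\<close> by (simp add: prime_dvd_fact_iff prime_card)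
  qed
  define Q where "Q = (\<Sum>i<k. smult (c i / of_nat (fact i)) (\<Prod>l<i. [:- of_nat l, 1:]))"
  have Q: "poly Q (of_nat n) = (\<Sum>i<k. c i * of_nat (n choose i))" for n
  proof -
    have "c i / of_nat (fact i) * (\<Prod>l<i. of_nat n - of_nat l) = c i * of_nat (n choose i)" if "i < k" for i
      using fact_nz[OF that] by (simp flip: of_nat_binomial_mult_fact)
    then show ?thesis by (simp add: Q_def poly_sum poly_prod)
  qed
  have "Q = 0"
  proof (rule ccontr)
    assume "Q \<noteq> 0"
    have "inj_on (\<lambda>j. of_nat (y j) :: 'p mod_ring) {..<k}"
    proof (rule inj_onI)
      fix i j assume ij: "i \<in> {..<k}" "j \<in> {..<k}" "of_nat (y i) = (of_nat (y j) :: 'p mod_ring)"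
      then have "[y i = y j] (mod CARD('p))" using of_nat_eq_iff_cong_CHAR[where ?'a = "'p mod_ring"] by simp
      then have "y i = y j" using y(2) ij by (simp add: cong_less_modulus_unique_nat)
      then show "i = j" using y(1) ij by (simp add: inj_on_eq_iff)
    qed
    then have "k = card ((\<lambda>j. of_nat (y j) :: 'p mod_ring) ` {..<k})" by (simp add: card_image)
    also have "\<dots> \<le> card {x. poly Q x = 0}"
      using c by (intro card_mono poly_roots_finite \<open>Q \<noteq> 0\<close>) (auto simp: Q)
    also have "\<dots> \<le> degree Q" by (rule poly_roots_degree[OF \<open>Q \<noteq> 0\<close>])
    also have "\<dots> < k"
      unfolding Q_def
    proof (rule degree_sum_less)
      fix i assume "i \<in> {..<k}"
      have "degree (\<Prod>l<i. [:- of_nat l, 1:] :: 'p mod_ring poly) \<le> (\<Sum>l<i. 1)"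
        by (intro order_trans[OF degree_prod_sum_le] sum_mono) auto
      then show "degree (smult (c i / of_nat (fact i)) (\<Prod>l<i. [:- of_nat l, 1:])) < k"
        using \<open>i \<in> {..<k}\<close> by (auto intro: le_less_trans[OF degree_smult_le])
    qed (use \<open>i < k\<close> in auto)
    finally show False by simp
  qed
  \<comment> \<open>Evaluating \<open>Q\<close> at \<open>0, 1, \<dots>, k - 1\<close> gives a triangular system for the coefficients.\<close>
  with \<open>i < k\<close> show ?thesis
  proof (induction i rule: less_induct)
    case (less n)
    have "0 = (\<Sum>i<k. c i * of_nat (n choose i))"
      using Q[of n] \<open>Q = 0\<close> by simp
    also have "\<dots> = (\<Sum>i<k. if i = n then c n else 0)"
    proof (rule sum.cong)
      fix i assume "i \<in> {..<k}"
      then show "c i * of_nat (n choose i) = (if i = n then c n else 0)"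
        using less by (cases i n rule: linorder_cases) (auto simp: binomial_eq_0)
    qed simp
    also have "\<dots> = c n" using less.prems by simp
    finally show ?case by simp
  qed
qed

text \<open>
  Chebotarev's theorem: every square submatrix of the Fourier matrix of prime order has trivial
  kernel. A kernel vector also annihilates the divided differences of the monomials at the nodes
  \<open>\<omega> ^ x i\<close>. The determinant of these divided differences is the value at \<open>\<omega>\<close> of an integer
  polynomial. Its vanishing implies that the value at \<open>1\<close>, where all nodes coincide and the divided
  differences are binomial coefficients, is divisible by \<open>p\<close>.
\<close>

theorem chebotarev_fourier_minors:
  fixes \<omega> :: complex and x y :: "nat \<Rightarrow> nat" and v :: "nat \<Rightarrow> complex"
  assumes \<omega>: "\<omega> ^ CARD('p :: prime_card) = 1" "\<omega> \<noteq> 1"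
    and x: "inj_on (\<lambda>i. \<omega> ^ x i) {..<k}"
    and y: "inj_on y {..<k}" "\<And>j. j < k \<Longrightarrow> y j < CARD('p)"
    and v: "\<And>i. i < k \<Longrightarrow> (\<Sum>j<k. v j * \<omega> ^ (x i * y j)) = 0"
    and "j < k"
  shows "v j = 0"
proof (rule ccontr)
  assume "v j \<noteq> 0"
  define z where "z = (\<lambda>i. \<omega> ^ x i)"
  have vanish: "(\<Sum>j<k. v j * divdiff z i (z l) (y j)) = 0" if "i \<le> l" "l < k" for i l
    using that
  proof (induction i arbitrary: l)
    case 0
    then show ?case using v[of l] by (simp add: z_def power_mult)
  next
    case (Suc i)
    have "(z l - z i) * (\<Sum>j<k. v j * divdiff z (Suc i) (z l) (y j)) =
        (\<Sum>j<k. v j * ((z l - z i) * divdiff z (Suc i) (z l) (y j)))"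
      by (simp add: sum_distrib_left algebra_simps del: divdiff.simps)
    also have "\<dots> = (\<Sum>j<k. v j * divdiff z i (z l) (y j)) - (\<Sum>j<k. v j * divdiff z i (z i) (y j))"
      unfolding divdiff_Suc by (simp add: right_diff_distrib sum_subtractf)
    also have "\<dots> = 0" using Suc.IH[of l] Suc.IH[of i] Suc.prems by simp
    finally have "(z l - z i) * (\<Sum>j<k. v j * divdiff z (Suc i) (z l) (y j)) = 0" .
    moreover have "z l \<noteq> z i"
      using inj_onD[OF x, of l i] Suc.prems by (auto simp: z_def)
    ultimately show ?case by simp
  qed
  define Z :: "nat \<Rightarrow> int poly" where "Z = (\<lambda>i. [:0, 1:] ^ x i)"
  define C where "C = mat k k (\<lambda>(i, j). divdiff Z i (Z i) (y j))"
  define h where "h = (\<lambda>F. poly (of_int_poly F) \<omega>)"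
  define h' where "h' = (\<lambda>F. of_int (poly F 1) :: 'p mod_ring)"
  interpret h: comm_ring_hom h
    by unfold_locales (simp_all add: h_def hom_distribs)
  interpret h': comm_ring_hom h'
    by unfold_locales (simp_all add: h'_def)
  have hZ: "(\<lambda>i. h (Z i)) = z" "(\<lambda>i. h' (Z i)) = (\<lambda>_. 1)"
    by (simp_all add: h_def h'_def Z_def z_def hom_distribs)
  have hZ': "h (Z i) = z i" "h' (Z i) = 1" for i
    using hZ by metis+
  have "map_mat h C = mat k k (\<lambda>(i, j). divdiff z i (z i) (y j))"
    by (rule eq_matI) (auto simp: C_def h.hom_divdiff hZ hZ')
  moreover have "det \<dots> = 0"
    unfolding det_eq_0_iff_right_kernel
    using vanish \<open>v j \<noteq> 0\<close> \<open>j < k\<close> by (intro exI[of _ v]) (auto simp: mult.commute)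
  ultimately have "poly (of_int_poly (det C)) \<omega> = 0"
    using h.hom_det[of C] by (simp add: h_def)
  then have "h' (det C) = 0"
    using prime_dvd_poly_1_if_root_of_unity[OF \<omega>]
    by (simp add: h'_def of_int_eq_0_iff_char_dvd)
  moreover have "map_mat h' C = mat k k (\<lambda>(i, j). of_nat (y j choose i))"
    by (rule eq_matI) (auto simp: C_def h'.hom_divdiff hZ hZ' divdiff_one)
  ultimately have "det (mat k k (\<lambda>(i, j). of_nat (y j choose i) :: 'p mod_ring)) = 0"
    using h'.hom_det[of C] by simp
  then obtain c i where "i < k" "c i \<noteq> (0 :: 'p mod_ring)"
      "\<And>j. j < k \<Longrightarrow> (\<Sum>i<k. c i * of_nat (y j choose i)) = 0"
    unfolding det_eq_0_iff_left_kernel by auto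
  with binomial_left_kernel_trivial[OF y] show False by blast
qed

section \<open>Characters of the cyclic group\<close>

text \<open>
  The representative of a residue class in \<open>{0..<p}\<close>, as a natural number.
\<close>

definition residue :: "'p :: nontriv mod_ring \<Rightarrow> nat" where
  "residue x = nat (to_int_mod_ring x)"

lemma to_int_mod_ring_bounds:
  "0 \<le> to_int_mod_ring (x :: 'p :: nontriv mod_ring)" "to_int_mod_ring x < int CARD('p)"
proof -
  have "to_int_mod_ring x \<in> {0..<int CARD('p)}"
    unfolding range_to_int_mod_ring[symmetric] by (rule rangeI)
  then show "0 \<le> to_int_mod_ring x" "to_int_mod_ring x < int CARD('p)" by simp_all
qed

lemma of_nat_residue [simp]: "of_nat (residue x) = x"
  by (simp add: residue_def of_nat_of_int_mod_ring to_int_mod_ring_bounds)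

lemma residue_less: "residue (x :: 'p :: nontriv mod_ring) < CARD('p)"
  using to_int_mod_ring_bounds[of x] by (simp add: residue_def nat_less_iff)

lemma inj_residue: "inj residue"
  by (metis injI of_nat_residue)

lemma power_eq_if_of_nat_eq:
  fixes z :: complex
  assumes "z ^ CARD('p :: nontriv) = 1" "of_nat a = (of_nat b :: 'p mod_ring)"
  shows "z ^ a = z ^ b"
proof -
  have red: "z ^ m = z ^ (m mod CARD('p))" for m
  proof -
    have "z ^ m = z ^ (CARD('p) * (m div CARD('p)) + m mod CARD('p))" by simp
    then show ?thesis unfolding power_add power_mult assms(1) by simp
  qed
  have "a mod CARD('p) = b mod CARD('p)"
    using assms(2) of_nat_eq_iff_cong_CHAR[where ?'a = "'p mod_ring", of a b] by (simp add: cong_def)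
  then show ?thesis using red by metis
qed

lemma dual_group_of_nat:
  assumes "\<xi> \<in> dual_group"
  shows "\<xi> (of_nat n :: 'p :: nontriv mod_ring) = \<xi> 1 ^ n"
proof (induction n)
  case 0
  have "\<xi> (0 + 0) = \<xi> 0 * \<xi> 0" "cmod (\<xi> 0) = 1"
    using assms unfolding dual_group_def by blast+
  then show ?case by auto
next
  case (Suc n)
  then show ?case using assms by (simp add: dual_group_def)
qed

lemma dual_group_eq_power:
  "\<xi> \<in> dual_group \<Longrightarrow> \<xi> x = \<xi> 1 ^ residue (x :: 'p :: nontriv mod_ring)"
  by (metis dual_group_of_nat of_nat_residue)

lemma bij_betw_dual_group_roots:
  "bij_betw (\<lambda>\<xi>. \<xi> 1) (dual_group :: ('p :: nontriv mod_ring \<Rightarrow> complex) set) {z. z ^ CARD('p) = 1}"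
  unfolding bij_betw_def
proof (intro conjI equalityI subsetI)
  show "inj_on (\<lambda>\<xi>. \<xi> 1) (dual_group :: ('p mod_ring \<Rightarrow> complex) set)"
    by (rule inj_onI) (metis dual_group_eq_power ext)
next
  fix z assume "z \<in> (\<lambda>\<xi>. \<xi> 1) ` (dual_group :: ('p mod_ring \<Rightarrow> complex) set)"
  then obtain \<xi> :: "'p mod_ring \<Rightarrow> complex" where \<xi>: "\<xi> \<in> dual_group" "z = \<xi> 1" by auto
  have "z ^ CARD('p) = \<xi> (of_nat CARD('p))" unfolding \<xi>(2) by (rule dual_group_of_nat[OF \<xi>(1), symmetric])
  also have "\<dots> = \<xi> (of_nat 0)" by simp
  also have "\<dots> = 1" using dual_group_of_nat[OF \<xi>(1), of 0] by simp
  finally show "z \<in> {z. z ^ CARD('p) = 1}" by simp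
next
  fix z :: complex assume "z \<in> {z. z ^ CARD('p) = 1}"
  then have z: "z ^ CARD('p) = 1" by simp
  then have "cmod z ^ CARD('p) = 1" by (metis norm_one norm_power)
  then have "cmod z = 1"
    using power_eq_imp_eq_base[of "cmod z" "CARD('p)" 1] by simp
  then have "(\<lambda>x :: 'p mod_ring. z ^ residue x) \<in> dual_group"
    unfolding dual_group_def
    by (auto simp: norm_power simp flip: power_add intro!: power_eq_if_of_nat_eq[OF z])
  moreover have "z ^ residue (1 :: 'p mod_ring) = z"
    using power_eq_if_of_nat_eq[OF z, of "residue (1 :: 'p mod_ring)" 1] by simp
  ultimately show "z \<in> (\<lambda>\<xi>. \<xi> 1) ` (dual_group :: ('p mod_ring \<Rightarrow> complex) set)"
    by (metis (mono_tags, lifting) image_eqI)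
qed

lemma card_dual_group: "card (dual_group :: ('p :: nontriv mod_ring \<Rightarrow> complex) set) = CARD('p)"
  using bij_betw_same_card[OF bij_betw_dual_group_roots[where ?'p = 'p]]
  by (simp add: card_roots_unity_eq)

lemma root_of_unity_eq_cis_power:
  fixes z :: complex
  assumes "z ^ n = 1" "n > 0"
  obtains a where "z = cis (2 * pi / n) ^ a"
proof -
  from assms bij_betw_roots_unity[of n] obtain a where "z = cis (2 * pi * real a / n)"
    by (auto simp: bij_betw_def)
  then have "z = cis (2 * pi / n) ^ a" by (simp add: DeMoivre mult.commute)
  then show thesis by (rule that)
qed

text \<open>
  Chebotarev's theorem in terms of characters: a function supported on \<open>J\<close> whose Fourier transform
  vanishes at \<open>card J\<close> characters is zero.
\<close>

theorem fourier_vanishing_imp_zero: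
  fixes f :: "'p :: prime_card mod_ring \<Rightarrow> complex"
  assumes \<Xi>: "\<Xi> \<subseteq> dual_group" "card \<Xi> = card J"
    and supp: "\<And>y. y \<notin> J \<Longrightarrow> f y = 0"
    and vanish: "\<And>\<xi>. \<xi> \<in> \<Xi> \<Longrightarrow> (\<Sum>y\<in>J. f y * cnj (\<xi> y)) = 0"
  shows "f y = 0"
proof (cases "y \<in> J")
  case True
  define k where "k = card J"
  have "finite \<Xi>" using \<Xi>(1) finite_dual_group finite_subset by blast
  then obtain s where s: "bij_betw s {0..<k} \<Xi>"
    using ex_bij_betw_nat_finite[of \<Xi>] \<Xi>(2) by (auto simp: k_def)
  obtain e where e: "bij_betw e {0..<k} J"
    using ex_bij_betw_nat_finite[of J] by (auto simp: k_def)
  define \<omega> where "\<omega> = cis (2 * pi / CARD('p))"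
  have p: "CARD('p) > 1" by (rule nontriv)
  have bij: "bij_betw (\<lambda>k. cis (2 * pi * real k / CARD('p))) {..<CARD('p)} {z. z ^ CARD('p) = 1}"
    by (rule bij_betw_roots_unity) simp
  have \<omega>1: "\<omega> ^ CARD('p) = 1"
    using bij_betwE[OF bij] p by (auto simp: \<omega>_def dest: bspec[of _ _ 1])
  have \<omega>2: "\<omega> \<noteq> 1"
    using inj_onD[OF bij_betw_imp_inj_on[OF bij], of 0 1] p by (auto simp: \<omega>_def)
  have s_dual: "s i \<in> dual_group" if "i < k" for i
    using s \<Xi>(1) that by (auto simp: bij_betw_def)
  have "\<exists>a. cnj (s i 1) = \<omega> ^ a" if "i < k" for i
  proof -
    have "s i 1 ^ CARD('p) = 1"
      using bij_betwE[OF bij_betw_dual_group_roots] s_dual[OF that] by auto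
    then have "cnj (s i 1) ^ CARD('p) = 1" by (metis complex_cnj_one complex_cnj_power)
    then show ?thesis unfolding \<omega>_def using root_of_unity_eq_cis_power zero_less_card_finite by metis
  qed
  then obtain x where x: "\<And>i. i < k \<Longrightarrow> cnj (s i 1) = \<omega> ^ x i" by metis
  have "inj_on (\<lambda>i. \<omega> ^ x i) {..<k}"
  proof (rule inj_onI)
    fix i j assume ij: "i \<in> {..<k}" "j \<in> {..<k}" "\<omega> ^ x i = \<omega> ^ x j"
    then have "s i 1 = s j 1" using x[of i] x[of j] by (metis complex_cnj_cancel_iff lessThan_iff)
    then have "s i = s j"
      using bij_betw_imp_inj_on[OF bij_betw_dual_group_roots] ij s_dual by (auto dest: inj_onD)
    then show "i = j" using s ij by (auto simp: bij_betw_def dest: inj_onD)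
  qed
  moreover have "inj_on (\<lambda>j. residue (e j)) {..<k}"
    using comp_inj_on[OF bij_betw_imp_inj_on[OF e] inj_on_subset[OF inj_residue subset_UNIV]]
    by (simp add: o_def atLeast0LessThan)
  moreover have "(\<Sum>j<k. f (e j) * \<omega> ^ (x i * residue (e j))) = 0" if "i < k" for i
  proof -
    have "(\<Sum>j<k. f (e j) * \<omega> ^ (x i * residue (e j))) = (\<Sum>j\<in>{0..<k}. f (e j) * cnj (s i (e j)))"
    proof (rule sum.cong)
      fix j
      have "cnj (s i (e j)) = cnj (s i 1) ^ residue (e j)"
        using dual_group_eq_power[OF s_dual[OF that], of "e j"] by simp
      then show "f (e j) * \<omega> ^ (x i * residue (e j)) = f (e j) * cnj (s i (e j))"
        by (simp add: x that power_mult)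
    qed auto
    also have "\<dots> = (\<Sum>y\<in>J. f y * cnj (s i y))"
      by (rule sum.reindex_bij_betw[OF e])
    also have "\<dots> = 0" using vanish s that by (auto simp: bij_betw_def)
    finally show ?thesis .
  qed
  ultimately have "f (e j) = 0" if "j < k" for j
    using chebotarev_fourier_minors[OF \<omega>1 \<omega>2, of x k "\<lambda>j. residue (e j)" "\<lambda>j. f (e j)"] that
    by (simp add: residue_less)
  then show ?thesis using e True by (auto simp: bij_betw_def)
qed (rule supp)

section \<open>Assignments of maximal weight\<close>

lemma card_Collect_permutes:
  assumes "\<rho> permutes A"
  shows "card {i \<in> A. P (\<rho> i)} = card {i \<in> A. P i}"
proof (rule bij_betw_same_card)
  show "bij_betw \<rho> {i \<in> A. P (\<rho> i)} {i \<in> A. P i}"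
    by (rule bij_betw_byWitness[where f' = "Hilbert_Choice.inv \<rho>"])
      (use permutes_in_image[OF assms] permutes_in_image[OF permutes_inv[OF assms]]
         in \<open>auto simp: permutes_inverses[OF assms] image_subset_iff\<close>)
qed

text \<open>
  The minors of the matrix of the short-time Fourier transform are sums over assignments of rows
  to columns. Column \<open>j\<close> stands for the point \<open>y j\<close>, row \<open>i\<close> has the time coordinate \<open>x i\<close>, and an
  assignment \<open>\<sigma>\<close> has the weight \<open>\<Sum>i. N (y i - x (\<sigma> i))\<close>. The growth condition on \<open>N\<close> makes a single
  large term dominate: let \<open>j\<close> be where the largest term occurs among the positions at which \<open>\<sigma>\<close>
  and \<open>\<tau>\<close> use different time coordinates. If that term belongs to \<open>\<sigma>\<close>, then a swap that gives
  column \<open>j\<close> the same time coordinate in \<open>\<tau>\<close> makes \<open>\<tau>\<close> heavier.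
\<close>

lemma exchange_increases_weight:
  fixes N :: "'g :: ab_group_add \<Rightarrow> nat" and x y :: "nat \<Rightarrow> 'g"
  assumes N: "inj N" "\<And>c d. N d < N c \<Longrightarrow> 2 * N d \<le> N c" "\<And>c. N c > 0"
    and y: "inj_on y {0..<n}"
    and perm: "\<sigma> permutes {0..<n}" "\<tau> permutes {0..<n}"
    and j: "j < n" "x (\<sigma> j) \<noteq> x (\<tau> j)"
    and max: "\<And>i. i < n \<Longrightarrow> x (\<sigma> i) \<noteq> x (\<tau> i) \<Longrightarrow>
      N (y i - x (\<sigma> i)) \<le> N (y j - x (\<sigma> j)) \<and> N (y i - x (\<tau> i)) \<le> N (y j - x (\<sigma> j))"
  shows "\<exists>\<rho>. \<rho> permutes {0..<n} \<and>
    (\<Sum>i=0..<n. N (y i - x (\<tau> i))) < (\<Sum>i=0..<n. N (y i - x (\<rho> i)))"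
proof -
  define c where "c = x (\<sigma> j)"
  \<comment> \<open>Both permutations use the time coordinate \<open>c\<close> equally often, so \<open>\<tau>\<close> uses it at some
    position where \<open>\<sigma>\<close> does not.\<close>
  obtain k where k: "k < n" "x (\<tau> k) = c" "x (\<sigma> k) \<noteq> c"
  proof (rule ccontr)
    assume "\<not> thesis"
    then have "{i \<in> {0..<n}. x (\<tau> i) = c} \<subseteq> {i \<in> {0..<n}. x (\<sigma> i) = c}" using that by auto
    then have "{i \<in> {0..<n}. x (\<tau> i) = c} = {i \<in> {0..<n}. x (\<sigma> i) = c}"
      by (rule card_subset_eq[rotated]) (simp_all only: card_Collect_permutes[OF perm(1), of "\<lambda>i. x i = c"] card_Collect_permutes[OF perm(2), of "\<lambda>i. x i = c"], simp)
    moreover have "j \<in> {i \<in> {0..<n}. x (\<sigma> i) = c}" using j(1) by (simp add: c_def)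
    ultimately have "x (\<tau> j) = c" by blast
    then show False using j(2) by (simp add: c_def)
  qed
  have "k \<noteq> j" using k j by (auto simp: c_def)
  define \<rho> where "\<rho> = \<tau> \<circ> Transposition.transpose j k"
  have \<rho>: "\<rho> permutes {0..<n}" unfolding \<rho>_def
    using perm(2) j(1) k(1) by (intro permutes_compose permutes_swap_id) auto
  have "N (y k - c) \<noteq> N (y j - c)"
    using k(1) j(1) \<open>k \<noteq> j\<close> by (simp add: inj_eq[OF N(1)] inj_on_eq_iff[OF y])
  moreover have "N (y k - c) \<le> N (y j - c)" using max[OF k(1)] k by (simp add: c_def)
  ultimately have 1: "2 * N (y k - c) \<le> N (y j - c)" by (intro N(2)) simp
  have "N (y j - x (\<tau> j)) \<noteq> N (y j - c)"
    using j(2) by (simp add: c_def inj_eq[OF N(1)])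
  moreover have "N (y j - x (\<tau> j)) \<le> N (y j - c)" using max[OF j] by (simp add: c_def)
  ultimately have 2: "2 * N (y j - x (\<tau> j)) \<le> N (y j - c)" by (intro N(2)) simp
  let ?I = "{0..<n} - {j} - {k}"
  have split: "(\<Sum>i=0..<n. h i) = h j + (h k + sum h ?I)" for h :: "nat \<Rightarrow> nat"
    using j(1) k(1) \<open>k \<noteq> j\<close> by (simp add: sum.remove[of _ j] sum.remove[of _ k])
  have "(\<Sum>i\<in>?I. N (y i - x (\<rho> i))) = (\<Sum>i\<in>?I. N (y i - x (\<tau> i)))"
    by (rule sum.cong) (auto simp: \<rho>_def Transposition.transpose_def)
  moreover have "N (y j - x (\<tau> j)) + N (y k - x (\<tau> k)) < N (y j - x (\<rho> j)) + N (y k - x (\<rho> k))"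
    using 1 2 N(3)[of "y k - x (\<tau> j)"] k(2) by (simp add: \<rho>_def)
  ultimately have "(\<Sum>i=0..<n. N (y i - x (\<tau> i))) < (\<Sum>i=0..<n. N (y i - x (\<rho> i)))"
    unfolding split[of "\<lambda>i. N (y i - x (\<tau> i))"] split[of "\<lambda>i. N (y i - x (\<rho> i))"] by linarith
  with \<rho> show ?thesis by blast
qed

lemma heaviest_permutations_agree:
  fixes N :: "'g :: ab_group_add \<Rightarrow> nat" and x y :: "nat \<Rightarrow> 'g"
  assumes N: "inj N" "\<And>c d. N d < N c \<Longrightarrow> 2 * N d \<le> N c" "\<And>c. N c > 0"
    and y: "inj_on y {0..<n}"
    and \<sigma>: "\<sigma> permutes {0..<n}" "\<And>\<rho>. \<rho> permutes {0..<n} \<Longrightarrow>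
      (\<Sum>i=0..<n. N (y i - x (\<rho> i))) \<le> (\<Sum>i=0..<n. N (y i - x (\<sigma> i)))"
    and \<tau>: "\<tau> permutes {0..<n}" "\<And>\<rho>. \<rho> permutes {0..<n} \<Longrightarrow>
      (\<Sum>i=0..<n. N (y i - x (\<rho> i))) \<le> (\<Sum>i=0..<n. N (y i - x (\<tau> i)))"
    and "i < n"
  shows "x (\<sigma> i) = x (\<tau> i)"
proof (rule ccontr)
  assume neq: "x (\<sigma> i) \<noteq> x (\<tau> i)"
  define A where "A = {i. i < n \<and> x (\<sigma> i) \<noteq> x (\<tau> i)}"
  define m where "m = (\<lambda>i. max (N (y i - x (\<sigma> i))) (N (y i - x (\<tau> i))))"
  have "finite A" "A \<noteq> {}" using neq \<open>i < n\<close> by (auto simp: A_def)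
  then obtain j where j: "j \<in> A" "\<And>i. i \<in> A \<Longrightarrow> m i \<le> m j"
    using obtains_MAX[of A m] by (metis Max_ge finite_imageI imageI)
  show False
  proof (cases "m j = N (y j - x (\<sigma> j))")
    case True
    have "\<exists>\<rho>. \<rho> permutes {0..<n} \<and>
        (\<Sum>i=0..<n. N (y i - x (\<tau> i))) < (\<Sum>i=0..<n. N (y i - x (\<rho> i)))"
      using j True by (intro exchange_increases_weight[OF N y \<sigma>(1) \<tau>(1), of j])
        (auto simp: A_def m_def)
    then show False using \<tau>(2) by (meson leD)
  next
    case False
    then have *: "m j = N (y j - x (\<tau> j))" by (auto simp: m_def max_def split: if_splits)
    have "\<exists>\<rho>. \<rho> permutes {0..<n} \<and>
        (\<Sum>i=0..<n. N (y i - x (\<sigma> i))) < (\<Sum>i=0..<n. N (y i - x (\<rho> i)))"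
      using j * by (intro exchange_increases_weight[OF N y \<tau>(1) \<sigma>(1), of j])
        (force simp: A_def m_def)+
    then show False using \<sigma>(2) by (meson leD)
  qed
qed

section \<open>A window with nonvanishing minors\<close>

lemma prod_monom: "(\<Prod>i\<in>A. monom (c i) (e i)) = monom (\<Prod>i\<in>A. c i) (\<Sum>i\<in>A. e i)"
  for c :: "'b \<Rightarrow> 'a :: comm_semiring_1"
  by (induction A rule: infinite_finite_induct) (simp_all add: mult_monom)

lemma coeff_signof_mult: "coeff (signof \<sigma> * q) d = signof \<sigma> * coeff (q :: 'a :: comm_ring_1 poly) d"
  by (simp add: sign_def)

text \<open>
  If the conjugated window values are replaced by \<open>t ^ N c\<close> for an indeterminate \<open>t\<close>, then every
  square minor of the short-time Fourier transform becomes a nonzero polynomial in \<open>t\<close>. Its coefficient at the largest weight collects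
  the heaviest permutations. These are exactly the permutations that assign to each column a row
  with a prescribed time coordinate, so the coefficient is the determinant of a matrix \<open>B\<close> which, up
  to reordering, is block diagonal with submatrices of the Fourier matrix as blocks.
\<close>

lemma stft_minor_polynomial_nonzero:
  fixes N :: "'p :: prime_card mod_ring \<Rightarrow> nat"
    and r :: "nat \<Rightarrow> 'p mod_ring \<times> ('p mod_ring \<Rightarrow> complex)" and y :: "nat \<Rightarrow> 'p mod_ring"
  assumes N: "inj N" "\<And>c d. N d < N c \<Longrightarrow> 2 * N d \<le> N c" "\<And>c. N c > 0"
    and y: "inj_on y {0..<n}"
    and r: "inj_on r {0..<n}" "\<And>i. i < n \<Longrightarrow> snd (r i) \<in> dual_group"
  shows "det (mat n n (\<lambda>(j, i). monom (cnj (snd (r i) (y j))) (N (y j - fst (r i))))) \<noteq> 0"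
    (is "det ?P \<noteq> 0")
proof -
  define x where "x = (\<lambda>i. fst (r i))"
  define \<chi> where "\<chi> = (\<lambda>j i. cnj (snd (r i) (y j)))"
  define S where "S = {\<sigma>. \<sigma> permutes {0..<n}}"
  define W where "W = (\<lambda>\<sigma>. \<Sum>j=0..<n. N (y j - x (\<sigma> j)))"
  have "finite S" by (simp add: S_def finite_permutations)
  moreover have "id \<in> S" by (simp add: S_def permutes_id)
  ultimately have "finite S" "S \<noteq> {}" by auto
  then obtain \<sigma>0 where "\<sigma>0 \<in> S" and max: "\<And>\<sigma>. \<sigma> \<in> S \<Longrightarrow> W \<sigma> \<le> W \<sigma>0"
    using obtains_MAX[of S W] by (metis Max_ge finite_imageI imageI)
  then have \<sigma>0: "\<sigma>0 permutes {0..<n}" by (simp add: S_def)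
  define a where "a = (\<lambda>j. x (\<sigma>0 j))"
  have W_eq_iff: "W \<sigma> = W \<sigma>0 \<longleftrightarrow> (\<forall>j<n. x (\<sigma> j) = a j)" if "\<sigma> \<in> S" for \<sigma>
  proof
    assume "W \<sigma> = W \<sigma>0"
    then show "\<forall>j<n. x (\<sigma> j) = a j"
      unfolding a_def using that \<sigma>0 max
      by (intro allI impI heaviest_permutations_agree[OF N y, where x = x])
        (auto simp: S_def W_def)
  next
    assume "\<forall>j<n. x (\<sigma> j) = a j"
    then show "W \<sigma> = W \<sigma>0" by (auto simp: W_def a_def intro!: sum.cong)
  qed
  define B where "B = (\<lambda>(j, i). if x i = a j then \<chi> j i else 0)"
  have "coeff (det ?P) (W \<sigma>0) =
      (\<Sum>\<sigma>\<in>S. signof \<sigma> * coeff (\<Prod>j=0..<n. monom (\<chi> j (\<sigma> j)) (N (y j - x (\<sigma> j)))) (W \<sigma>0))"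
  proof -
    have "det ?P = (\<Sum>\<sigma>\<in>S. signof \<sigma> * (\<Prod>j=0..<n. monom (\<chi> j (\<sigma> j)) (N (y j - x (\<sigma> j)))))"
      unfolding S_def \<chi>_def x_def
      by (subst det_def'[of _ n]) (auto intro!: sum.cong prod.cong simp: permutes_in_image)
    then show ?thesis by (simp only: coeff_sum coeff_signof_mult)
  qed
  also have "\<dots> = (\<Sum>\<sigma>\<in>S. signof \<sigma> * (\<Prod>j=0..<n. B (j, \<sigma> j)))"
  proof (rule sum.cong)
    fix \<sigma> assume "\<sigma> \<in> S"
    have "coeff (\<Prod>j=0..<n. monom (\<chi> j (\<sigma> j)) (N (y j - x (\<sigma> j)))) (W \<sigma>0) =
        (if W \<sigma> = W \<sigma>0 then \<Prod>j=0..<n. \<chi> j (\<sigma> j) else 0)"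
      unfolding prod_monom W_def by simp
    also have "\<dots> = (\<Prod>j=0..<n. B (j, \<sigma> j))"
    proof (cases "\<forall>j<n. x (\<sigma> j) = a j")
      case True
      then show ?thesis using W_eq_iff[OF \<open>\<sigma> \<in> S\<close>] by (auto simp: B_def intro!: prod.cong)
    next
      case False
      then obtain j where "j < n" "B (j, \<sigma> j) = 0" by (auto simp: B_def)
      then have "(\<Prod>j=0..<n. B (j, \<sigma> j)) = 0" by (intro prod_zero) auto
      moreover have "W \<sigma> \<noteq> W \<sigma>0" using False W_eq_iff[OF \<open>\<sigma> \<in> S\<close>] by blast
      ultimately show ?thesis by simp
    qed
    finally show "signof \<sigma> * coeff (\<Prod>j=0..<n. monom (\<chi> j (\<sigma> j)) (N (y j - x (\<sigma> j)))) (W \<sigma>0) =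
        signof \<sigma> * (\<Prod>j=0..<n. B (j, \<sigma> j))" by simp
  qed simp
  also have "\<dots> = det (mat n n B)"
    unfolding S_def by (subst det_def'[of _ n]) (auto intro!: sum.cong prod.cong simp: permutes_in_image)
  finally have coeff: "coeff (det ?P) (W \<sigma>0) = det (mat n n B)" .
  have "det (mat n n B) \<noteq> 0"
  proof
    assume "det (mat n n B) = 0"
    then obtain v j0 where j0: "j0 < n" "v j0 \<noteq> 0"
      and v: "\<And>i. i < n \<Longrightarrow> (\<Sum>j<n. v j * B (j, i)) = 0"
      unfolding det_eq_0_iff_left_kernel by blast
    \<comment> \<open>\<open>J\<close> and \<open>I\<close> are the columns and rows of the block containing the column \<open>j0\<close>.\<close>
    define J where "J = {j \<in> {0..<n}. a j = a j0}"
    define I where "I = {i \<in> {0..<n}. x i = a j0}"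
    have y_J: "inj_on y J" by (rule inj_on_subset[OF y]) (auto simp: J_def)
    define f where "f = (\<lambda>z. if z \<in> y ` J then v (the_inv_into J y z) else 0)"
    have f_y: "f (y j) = v j" if "j \<in> J" for j
      using that by (simp add: f_def the_inv_into_f_f[OF y_J])
    have inj: "inj_on (\<lambda>i. snd (r i)) I"
    proof (rule inj_onI)
      fix i i' assume "i \<in> I" "i' \<in> I" "snd (r i) = snd (r i')"
      then have "r i = r i'" "i \<in> {0..<n}" "i' \<in> {0..<n}" by (auto simp: I_def x_def prod_eq_iff)
      then show "i = i'" using r(1) by (auto dest: inj_onD)
    qed
    have "f (y j0) = 0"
    proof (rule fourier_vanishing_imp_zero[of "(\<lambda>i. snd (r i)) ` I" "y ` J"])
      show "(\<lambda>i. snd (r i)) ` I \<subseteq> dual_group" using r(2) by (auto simp: I_def)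
      show "card ((\<lambda>i. snd (r i)) ` I) = card (y ` J)"
        unfolding card_image[OF inj] card_image[OF y_J]
        unfolding I_def J_def a_def
        by (rule card_Collect_permutes[OF \<sigma>0, symmetric])
      show "f z = 0" if "z \<notin> y ` J" for z using that by (simp add: f_def)
      fix \<xi> assume "\<xi> \<in> (\<lambda>i. snd (r i)) ` I"
      then obtain i where i: "i < n" "x i = a j0" "\<xi> = snd (r i)" by (auto simp: I_def)
      have "(\<Sum>z\<in>y ` J. f z * cnj (\<xi> z)) = (\<Sum>j\<in>J. v j * \<chi> j i)"
        by (simp add: sum.reindex[OF y_J] f_y i(3) \<chi>_def)
      also have "\<dots> = (\<Sum>j<n. v j * B (j, i))"
        by (rule sum.mono_neutral_cong_left) (auto simp: J_def B_def i(2))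
      finally show "(\<Sum>z\<in>y ` J. f z * cnj (\<xi> z)) = 0" using v[OF i(1)] by simp
    qed
    moreover have "j0 \<in> J" using j0 by (simp add: J_def)
    ultimately show False using j0 f_y by simp
  qed
  then show ?thesis using coeff by auto
qed

lemma infinite_unit_circle: "infinite {z :: complex. cmod z = 1}"
proof
  assume fin: "finite {z :: complex. cmod z = 1}"
  define n where "n = Suc (card {z :: complex. cmod z = 1})"
  have "cmod z = 1" if "z ^ n = 1" for z
  proof -
    have "cmod z ^ n = 1 ^ n" using that by (simp flip: norm_power)
    then show ?thesis by (rule power_eq_imp_eq_base) (simp_all add: n_def)
  qed
  then have "card {z :: complex. z ^ n = 1} \<le> card {z :: complex. cmod z = 1}"
    by (intro card_mono fin) auto
  then show False using card_roots_unity_eq[of n] by (simp add: n_def)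
qed

text \<open>
  There are only finitely many minors, so some \<open>\<zeta>\<close> on the unit circle is a root of none of the
  corresponding polynomials. The window \<open>g c = cnj (\<zeta> ^ N c)\<close> then has the required property.
\<close>

theorem exists_unimodular_window_with_nonzero_minors:
  "\<exists>g :: 'p :: prime_card mod_ring \<Rightarrow> complex. (\<forall>x. cmod (g x) = 1) \<and>
    (\<forall>f J R. R \<subseteq> UNIV \<times> dual_group \<longrightarrow> card R = card J \<longrightarrow> (\<forall>y. y \<notin> J \<longrightarrow> f y = 0) \<longrightarrow>
       (\<forall>r\<in>R. stft g f r = 0) \<longrightarrow> f = (\<lambda>_. 0))"
proof -
  define N where "N = (\<lambda>c :: 'p mod_ring. 2 ^ residue c :: nat)"
  have N: "2 * N d \<le> N c" if "N d < N c" for c d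
  proof -
    have "residue d < residue c" using that by (simp add: N_def)
    then have "(2 :: nat) ^ Suc (residue d) \<le> 2 ^ residue c" by (intro power_increasing) auto
    then show ?thesis by (simp add: N_def)
  qed
  have inj_N: "inj N" using inj_residue by (auto simp: N_def inj_def)
  define M where "M = (\<lambda>rs :: ('p mod_ring \<times> ('p mod_ring \<Rightarrow> complex)) list. \<lambda>ys.
    mat (length ys) (length ys)
      (\<lambda>(j, i). monom (cnj (snd (rs ! i) (ys ! j))) (N (ys ! j - fst (rs ! i)))))"
  \<comment> \<open>Lists index the rows and columns of the minors, so that finitely many of them
    suffice.\<close>
  define L where "L = {rs :: ('p mod_ring \<times> ('p mod_ring \<Rightarrow> complex)) list.
    set rs \<subseteq> UNIV \<times> dual_group \<and> length rs \<le> CARD('p)} \<times>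
    {ys :: 'p mod_ring list. set ys \<subseteq> UNIV \<and> length ys \<le> CARD('p)}"
  have "finite L" unfolding L_def
    by (intro finite_cartesian_product finite_lists_length_le finite_dual_group) simp_all
  define Z where "Z = (\<Union>(rs, ys)\<in>{(rs, ys) \<in> L. det (M rs ys) \<noteq> 0}. {z. poly (det (M rs ys)) z = 0})"
  have "finite Z" unfolding Z_def
  proof (rule finite_UN_I)
    show "finite {(rs, ys) \<in> L. det (M rs ys) \<noteq> 0}"
      by (rule finite_subset[OF _ \<open>finite L\<close>]) auto
  qed (auto intro: poly_roots_finite)
  then have "\<not> {z. cmod z = 1} \<subseteq> Z" using infinite_unit_circle finite_subset by blast
  then obtain \<zeta> where "cmod \<zeta> = 1" "\<zeta> \<notin> Z" by auto
  have \<zeta>: "poly (det (M rs ys)) \<zeta> \<noteq> 0" if "(rs, ys) \<in> L" "det (M rs ys) \<noteq> 0" for rs ys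
    using \<open>\<zeta> \<notin> Z\<close> that unfolding Z_def by blast
  define g where "g = (\<lambda>c. cnj (\<zeta> ^ N c))"
  have "f = (\<lambda>_. 0)"
    if R: "R \<subseteq> UNIV \<times> dual_group" "card R = card J" and supp: "\<forall>y. y \<notin> J \<longrightarrow> f y = 0"
      and vanish: "\<forall>r\<in>R. stft g f r = 0" for f J R
  proof -
    have "finite R" using R(1) by (rule finite_subset) (simp add: finite_dual_group)
    then obtain rs where rs: "set rs = R" "distinct rs" using finite_distinct_list by blast
    obtain ys where ys: "set ys = J" "distinct ys" using finite_distinct_list[of J] by auto
    define n where "n = card J"
    have len: "length rs = n" "length ys = n"
      using rs ys R(2) distinct_card by (metis n_def)+
    have "n \<le> CARD('p)" using card_mono[of UNIV J] by (simp add: n_def)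
    then have "(rs, ys) \<in> L" using rs ys R len by (auto simp: L_def)
    moreover have "det (M rs ys) \<noteq> 0" unfolding M_def len
    proof (rule stft_minor_polynomial_nonzero[OF inj_N N])
      show "inj_on ((!) ys) {0..<n}" "inj_on ((!) rs) {0..<n}"
        using rs ys len by (auto intro: inj_on_nth)
      show "snd (rs ! i) \<in> dual_group" if "i < n" for i
        using R(1) rs(1) len(1) nth_mem[of i rs] that by (auto simp: mem_Times_iff)
    qed (simp_all add: N_def)
    ultimately have "poly (det (M rs ys)) \<zeta> \<noteq> 0" by (rule \<zeta>)
    have eval: "comm_ring_hom (\<lambda>q. poly q \<zeta>)" by unfold_locales simp_all
    have "map_mat (\<lambda>q. poly q \<zeta>) (M rs ys) =
        mat n n (\<lambda>(j, i). cnj (snd (rs ! i) (ys ! j)) * \<zeta> ^ N (ys ! j - fst (rs ! i)))"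
      by (rule eq_matI) (auto simp: M_def len poly_monom)
    then have nz: "det (mat n n (\<lambda>(j, i). cnj (snd (rs ! i) (ys ! j)) * \<zeta> ^ N (ys ! j - fst (rs ! i)))) \<noteq> 0"
      using comm_ring_hom.hom_det[OF eval, of "M rs ys"] \<open>poly (det (M rs ys)) \<zeta> \<noteq> 0\<close> by simp
    have "(\<Sum>j<n. f (ys ! j) * (cnj (snd (rs ! i) (ys ! j)) * \<zeta> ^ N (ys ! j - fst (rs ! i)))) = 0"
      if "i < n" for i
    proof -
      have "(\<Sum>j<n. f (ys ! j) * (cnj (snd (rs ! i) (ys ! j)) * \<zeta> ^ N (ys ! j - fst (rs ! i)))) =
          (\<Sum>y\<in>J. f y * (cnj (snd (rs ! i) y) * \<zeta> ^ N (y - fst (rs ! i))))"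
        by (rule sum.reindex_bij_betw[OF bij_betw_nth]) (use ys len in auto)
      also have "\<dots> = (\<Sum>y\<in>UNIV. f y * (cnj (snd (rs ! i) y) * \<zeta> ^ N (y - fst (rs ! i))))"
        by (rule sum.mono_neutral_left) (use supp in auto)
      also have "\<dots> = stft g f (rs ! i)"
        by (simp add: stft_def g_def case_prod_beta mult_ac)
      also have "\<dots> = 0" using vanish rs len that nth_mem by blast
      finally show ?thesis .
    qed
    then have "f (ys ! j) = 0" if "j < n" for j
      using nz that unfolding det_eq_0_iff_left_kernel by (auto dest!: spec[of _ "\<lambda>j. f (ys ! j)"])
    then show "f = (\<lambda>_. 0)" using supp ys len by (metis ext in_set_conv_nth)
  qed
  moreover have "cmod (g x) = 1" for x by (simp add: g_def norm_power \<open>cmod \<zeta> = 1\<close>)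
  ultimately show ?thesis by (intro exI[of _ g]) blast
qed

section \<open>Functions with prescribed numbers of nonzero values\<close>

lemma underdetermined_system_has_solution:
  fixes K :: "'r \<Rightarrow> 'c \<Rightarrow> 'a :: idom"
  assumes "finite R" "finite J" "card R < card J"
  obtains f where "f \<noteq> (\<lambda>_. 0)" "\<And>y. y \<notin> J \<Longrightarrow> f y = 0" "\<And>r. r \<in> R \<Longrightarrow> (\<Sum>y\<in>J. f y * K r y) = 0"
proof -
  define n where "n = card J"
  obtain e where e: "bij_betw e {0..<n} J"
    using ex_bij_betw_nat_finite[OF assms(2)] by (auto simp: n_def)
  obtain s where s: "bij_betw s {0..<card R} R"
    using ex_bij_betw_nat_finite[OF assms(1)] by auto
  define M where "M = (\<lambda>(i, j). if i < card R then K (s i) (e j) else 0)"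
  have "det (mat n n M) = 0"
    unfolding det_eq_0_iff_left_kernel
    using assms(3) by (intro exI[of _ "\<lambda>i. if i < card R then 0 else 1"])
      (auto simp: M_def n_def intro!: sum.neutral)
  then obtain v j where j: "j < n" "v j \<noteq> 0" and v: "\<And>i. i < n \<Longrightarrow> (\<Sum>j<n. M (i, j) * v j) = 0"
    unfolding det_eq_0_iff_right_kernel by blast
  have inj: "inj_on e {0..<n}" using e by (rule bij_betw_imp_inj_on)
  define f where "f = (\<lambda>y. if y \<in> J then v (the_inv_into {0..<n} e y) else 0)"
  have f_e: "f (e i) = v i" if "i < n" for i
    using that e by (auto simp: f_def the_inv_into_f_f[OF inj] bij_betw_def)
  show thesis
  proof
    show "f \<noteq> (\<lambda>_. 0)" using j f_e by metis
    show "f y = 0" if "y \<notin> J" for y using that by (simp add: f_def)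
    fix r assume "r \<in> R"
    then obtain i where i: "i < card R" "r = s i"
      using bij_betw_imp_surj_on[OF s] by (metis atLeastLessThan_iff imageE)
    have "(\<Sum>y\<in>J. f y * K r y) = (\<Sum>j\<in>{0..<n}. f (e j) * K r (e j))"
      by (rule sum.reindex_bij_betw[OF e, symmetric])
    also have "\<dots> = (\<Sum>j<n. M (i, j) * v j)"
      by (rule sum.cong) (auto simp: M_def i f_e)
    also have "\<dots> = 0" using v i(1) assms(3) by (simp add: n_def)
    finally show "(\<Sum>y\<in>J. f y * K r y) = 0" .
  qed
qed

text \<open>
  Finitely many linear functionals, none of which is identically zero on the complex subspace \<open>W\<close>,
  are all nonzero at some point of \<open>W\<close>. The closure property \<open>closed\<close> already makes
  the nonempty set \<open>W\<close> a subspace.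
\<close>

lemma exists_common_nonvanishing:
  fixes W :: "('c \<Rightarrow> complex) set" and T :: "(('c \<Rightarrow> complex) \<Rightarrow> complex) set"
  assumes "finite T" "W \<noteq> {}"
    and closed: "\<And>f g c. f \<in> W \<Longrightarrow> g \<in> W \<Longrightarrow> (\<lambda>y. f y + c * g y) \<in> W"
    and linear: "\<And>\<phi> f g c. \<phi> \<in> T \<Longrightarrow> \<phi> (\<lambda>y. f y + c * g y) = \<phi> f + c * \<phi> g"
    and nonzero: "\<And>\<phi>. \<phi> \<in> T \<Longrightarrow> \<exists>f\<in>W. \<phi> f \<noteq> 0"
  shows "\<exists>f\<in>W. \<forall>\<phi>\<in>T. \<phi> f \<noteq> 0"
  using assms(1,4,5)
proof (induction T rule: finite_induct)
  case empty
  then show ?case using \<open>W \<noteq> {}\<close> by auto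
next
  case (insert \<psi> T)
  have "\<exists>f\<in>W. \<forall>\<phi>\<in>T. \<phi> f \<noteq> 0"
    using insert.prems by (intro insert.IH) auto
  then obtain f where f: "f \<in> W" "\<And>\<phi>. \<phi> \<in> T \<Longrightarrow> \<phi> f \<noteq> 0" by blast
  obtain g where g: "g \<in> W" "\<psi> g \<noteq> 0" using insert.prems(2)[of \<psi>] by blast
  have "finite ((\<lambda>\<phi>. - \<phi> f / \<phi> g) ` insert \<psi> T)" using insert.hyps(1) by simp
  then obtain c where c: "c \<notin> (\<lambda>\<phi>. - \<phi> f / \<phi> g) ` insert \<psi> T"
    using ex_new_if_finite infinite_UNIV_char_0 by blast
  have "\<phi> (\<lambda>y. f y + c * g y) \<noteq> 0" if "\<phi> \<in> insert \<psi> T" for \<phi>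
  proof
    assume "\<phi> (\<lambda>y. f y + c * g y) = 0"
    then have *: "\<phi> f + c * \<phi> g = 0" using insert.prems(1)[OF that] by metis
    have "\<phi> g \<noteq> 0"
    proof
      assume "\<phi> g = 0"
      then have "\<phi> \<in> T" "\<phi> f = 0" using that g * by auto
      then show False using f by blast
    qed
    then have "c = - \<phi> f / \<phi> g" using * by (simp add: field_simps eq_neg_iff_add_eq_0)
    then show False using c that by blast
  qed
  then show ?case using closed[OF f(1) g(1)] by blast
qed

lemma stft_linear: "stft g (\<lambda>y. f y + c * h y) r = stft g f r + c * stft g h r"
  by (cases r) (simp add: stft_def sum.distrib sum_distrib_left algebra_simps)

theorem proposition4p7:
  shows "\<exists>g :: 'p::prime_card mod_ring \<Rightarrow> complex.
    (\<forall>x. cmod (g x) = 1) \<and>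
    (\<forall>f. f \<noteq> (\<lambda>_. 0) \<longrightarrow>
       norm0 UNIV f + norm0 (UNIV \<times> dual_group) (stft g f) \<ge> CARD('p) ^ 2 + 1) \<and>
    (\<forall>k l :: nat. 1 \<le> k \<and> k \<le> CARD('p) \<and> 1 \<le> l \<and> l \<le> CARD('p) ^ 2 \<and>
       k + l \<ge> CARD('p) ^ 2 + 1 \<longrightarrow>
       (\<exists>f. norm0 UNIV f = k \<and> norm0 (UNIV \<times> dual_group) (stft g f) = l))"
proof -
  define A :: "('p mod_ring \<times> ('p mod_ring \<Rightarrow> complex)) set" where "A = UNIV \<times> dual_group"
  have fin: "finite A" by (simp add: A_def finite_dual_group)
  have card_A: "card A = CARD('p) ^ 2"
    by (simp add: A_def card_cartesian_product card_dual_group power2_eq_square)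
  obtain g :: "'p mod_ring \<Rightarrow> complex" where g: "\<And>x. cmod (g x) = 1"
    and minors: "\<And>f J R. R \<subseteq> A \<Longrightarrow> card R = card J \<Longrightarrow> (\<And>y. y \<notin> J \<Longrightarrow> f y = 0) \<Longrightarrow>
       (\<And>r. r \<in> R \<Longrightarrow> stft g f r = 0) \<Longrightarrow> f = (\<lambda>_. 0)"
    using exists_unimodular_window_with_nonzero_minors[where ?'p = 'p] unfolding A_def by metis
  define zeros where "zeros = (\<lambda>f. {r \<in> A. stft g f r = 0})"
  have norm0_stft: "norm0 A (stft g f) = CARD('p) ^ 2 - card (zeros f)" "card (zeros f) \<le> CARD('p) ^ 2" for f
  proof -
    have "{r \<in> A. stft g f r \<noteq> 0} = A - zeros f" by (auto simp: zeros_def)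
    then show "norm0 A (stft g f) = CARD('p) ^ 2 - card (zeros f)"
      using fin by (simp add: norm0_def card_Diff_subset zeros_def card_A)
    show "card (zeros f) \<le> CARD('p) ^ 2"
      unfolding card_A[symmetric] by (intro card_mono fin) (auto simp: zeros_def)
  qed
  have zeros_less: "card (zeros f) < card J" if "f \<noteq> (\<lambda>_. 0)" "\<And>y. y \<notin> J \<Longrightarrow> f y = 0" for f J
  proof (rule ccontr)
    assume "\<not> card (zeros f) < card J"
    then obtain R where R: "R \<subseteq> zeros f" "card R = card J"
      using obtain_subset_with_card_n[of "card J" "zeros f"] by (metis not_less)
    then have "f = (\<lambda>_. 0)"
      by (intro minors[of R J]) (auto simp: zeros_def that(2))
    then show False using that by simp
  qed
  have "CARD('p) ^ 2 + 1 \<le> norm0 UNIV f + norm0 A (stft g f)" if "f \<noteq> (\<lambda>_. 0)" for f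
    using zeros_less[OF that, of "{y. f y \<noteq> 0}"] norm0_stft[of f] by (simp add: norm0_def)
  moreover have "\<exists>f. norm0 UNIV f = k \<and> norm0 A (stft g f) = l"
    if kl: "1 \<le> k" "k \<le> CARD('p)" "1 \<le> l" "l \<le> CARD('p) ^ 2" "CARD('p) ^ 2 + 1 \<le> k + l" for k l
  proof -
    define m where "m = CARD('p) ^ 2 - l"
    have m: "m < k" "l = CARD('p) ^ 2 - m" using kl by (auto simp: m_def)
    obtain J :: "'p mod_ring set" where J: "card J = k"
      using obtain_subset_with_card_n[of k "UNIV :: 'p mod_ring set"] kl by auto
    obtain R where R: "R \<subseteq> A" "card R = m"
      using obtain_subset_with_card_n[of m A] by (auto simp: card_A m_def)
    have "finite R" using R(1) fin by (rule finite_subset)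
    define W where "W = {f. (\<forall>y. y \<notin> J \<longrightarrow> f y = 0) \<and> (\<forall>r\<in>R. stft g f r = 0)}"
    \<comment> \<open>On \<open>m + 1\<close> points there is a nonzero solution of the \<open>m\<close> equations given by \<open>R\<close>, and the
      bound already proved forces it to have no further zeros.\<close>
    have tight: "\<exists>f\<in>W. (\<forall>y\<in>J'. f y \<noteq> 0) \<and> (\<forall>r\<in>A - R. stft g f r \<noteq> 0)"
      if J': "J' \<subseteq> J" "card J' = m + 1" for J'
    proof -
      obtain f where f: "f \<noteq> (\<lambda>_. 0)" "\<And>y. y \<notin> J' \<Longrightarrow> f y = 0"
        and ker: "\<And>r. r \<in> R \<Longrightarrow> (\<Sum>y\<in>J'. f y * (cnj (g (y - fst r)) * cnj (snd r y))) = 0"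
        using underdetermined_system_has_solution[OF \<open>finite R\<close>, of J'
            "\<lambda>r y. cnj (g (y - fst r)) * cnj (snd r y)"] R(2) J'(2) by auto
      have vanish: "stft g f r = 0" if "r \<in> R" for r
      proof -
        have "stft g f r = (\<Sum>y\<in>UNIV. f y * (cnj (g (y - fst r)) * cnj (snd r y)))"
          by (simp add: stft_def case_prod_beta mult.assoc)
        also have "\<dots> = (\<Sum>y\<in>J'. f y * (cnj (g (y - fst r)) * cnj (snd r y)))"
          by (rule sum.mono_neutral_right) (auto simp: f(2))
        finally show ?thesis using ker[OF that] by simp
      qed
      then have R_zeros: "R \<subseteq> zeros f" using R(1) by (auto simp: zeros_def)
      have fin_zeros: "finite (zeros f)" using fin by (simp add: zeros_def)
      have "card (zeros f) \<le> m" using zeros_less[OF f, of J'] J'(2) by simp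
      then have "R = zeros f" using R_zeros R(2) by (intro card_seteq fin_zeros) auto
      then have "\<forall>r\<in>A - R. stft g f r \<noteq> 0" by (auto simp: zeros_def)
      moreover have "f y \<noteq> 0" if "y \<in> J'" for y
      proof
        assume "f y = 0"
        have "card (zeros f) < card (J' - {y})"
          by (rule zeros_less[OF f(1)]) (use f(2) \<open>f y = 0\<close> in auto)
        then show False using that J'(2) R(2) \<open>R = zeros f\<close> by simp
      qed
      moreover have "f \<in> W" using f(2) J'(1) vanish by (auto simp: W_def)
      ultimately show ?thesis by blast
    qed
    \<comment> \<open>The functionals that must not vanish: the values on \<open>J\<close> and the transform off \<open>R\<close>.\<close>
    define T where "T = (\<lambda>y f. f y) ` J \<union> (\<lambda>r f. stft g f r) ` (A - R)"
    have "\<exists>f\<in>W. \<forall>\<phi>\<in>T. \<phi> f \<noteq> 0"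
    proof (rule exists_common_nonvanishing)
      show "finite T" using fin by (simp add: T_def)
      show "W \<noteq> {}" by (auto simp: W_def stft_def intro!: exI[of _ "\<lambda>_. 0"])
      show "(\<lambda>y. f y + c * h y) \<in> W" if "f \<in> W" "h \<in> W" for f h c
        using that by (simp add: W_def stft_linear)
      show "\<phi> (\<lambda>y. f y + c * h y) = \<phi> f + c * \<phi> h" if "\<phi> \<in> T" for \<phi> f h c
        using that by (auto simp: T_def stft_linear)
      fix \<phi> assume "\<phi> \<in> T"
      then consider y where "y \<in> J" "\<phi> = (\<lambda>f. f y)" | r where "r \<in> A - R" "\<phi> = (\<lambda>f. stft g f r)"
        by (auto simp: T_def)
      then show "\<exists>f\<in>W. \<phi> f \<noteq> 0"
      proof cases
        case 1
        have "m \<le> card (J - {y})" using m(1) J 1(1) by simp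
        then obtain J0 where "J0 \<subseteq> J - {y}" "card J0 = m"
          using obtain_subset_with_card_n by metis
        then have "insert y J0 \<subseteq> J" "card (insert y J0) = m + 1"
          using 1(1) by (auto simp: card_insert_if subset_Diff_insert)
        then show ?thesis using tight[of "insert y J0"] 1(2) by blast
      next
        case 2
        have "m + 1 \<le> card J" using m(1) J by simp
        then obtain J0 where "J0 \<subseteq> J" "card J0 = m + 1"
          using obtain_subset_with_card_n by metis
        then show ?thesis using tight[of J0] 2 by blast
      qed
    qed
    then obtain f where f: "f \<in> W" "\<And>\<phi>. \<phi> \<in> T \<Longrightarrow> \<phi> f \<noteq> 0" by blast
    have "f y \<noteq> 0" if "y \<in> J" for y using f(2)[of "\<lambda>f. f y"] that by (auto simp: T_def)
    then have "{y. f y \<noteq> 0} = J" using f(1) by (auto simp: W_def)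
    moreover have "stft g f r \<noteq> 0" if "r \<in> A - R" for r
      using f(2)[of "\<lambda>f. stft g f r"] that by (auto simp: T_def)
    then have "zeros f = R" using f(1) R(1) by (auto simp: W_def zeros_def)
    ultimately have "norm0 UNIV f = k \<and> norm0 A (stft g f) = l"
      using J R(2) m(2) norm0_stft(1)[of f] by (simp add: norm0_def)
    then show ?thesis by blast
  qed
  ultimately show ?thesis
    unfolding A_def using g by (intro exI[of _ g]) blast
qed

end
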